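(* Let $v,w\ge 0$ be integers with $v+w\ge 5$ and $v\le w$. Then $$wavecost\ \mathscr{MON}(v+w,v;4,1)=wavecost\ \mathscr{MON}(v+w,4).$$
   Context: Let $n\ge v\ge 0$ and let $C>C'\ge 1$ be integers. Let $X$ be a set of $n$ vertices, $K_n$ the complete graph on $X$, and $V\subseteq X$ a fixed subset with $|V|=v$; write $w=n-v$. A grooming $N(n,C)$ is a partition of the edge set $E(K_n)$ into (nonempty, not necessarily connected) subgraphs $B_1,\dots,B_\Lambda$ of $K_n$, without isolated vertices, such that $|E(B_k)|\le C$ for all $k$. A grooming $N(n,v;C,C')$ is an $N(n,C)$ in which, moreover, each $B_k$ contains at most $C'$ edges having both ends in $V$. The (drop) cost of a grooming is $\sum_{k=1}^{\Lambda}|V(B_k)|$, and its number of wavelengths (wavecost) is $\Lambda$. $\mathscr{ON}(n,C)$ (respectively $\mathscr{ON}(n,v;C,C')$) denotes a grooming $N(n,C)$ (respectively $N(n,v;C,C')$) of minimum cost. $\mathscr{MON}(n,C)$ (respectively $\mathscr{MON}(n,v;C,C')$) denotes one whose number of wavelengths is minimum among all $\mathscr{ON}(n,C)$ (respectively all $\mathscr{ON}(n,v;C,C')$), i.e. among minimum-cost groomings only, and $wavecost\ \mathscr{MON}(\cdot)$ denotes that minimum number of wavelengths. *)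

theory Defs
  imports "HOL-Library.Ramsey" "HOL-Library.Disjoint_Sets"
begin

text \<open>
  The edge set of the complete graph on \<open>X\<close> is \<open>nsets X 2\<close>, the set of two-element subsets
  of \<open>X\<close>. A subgraph without isolated vertices is determined by its edges, so a block is
  represented by its edge set \<open>B\<close>, and its vertex set is \<open>\<Union>B\<close>. The blocks of a grooming are
  pairwise disjoint and nonempty (by \<^const>\<open>partition_on\<close>), hence pairwise distinct, so a set of
  blocks suffices.
\<close>

type_synonym 'a block = "'a set set"

definition groomings :: "'a set \<Rightarrow> nat \<Rightarrow> 'a block set set" where
  "groomings X C = {G. partition_on (nsets X 2) G \<and> (\<forall>B\<in>G. card B \<le> C)}"

definition groomings2 :: "'a set \<Rightarrow> 'a set \<Rightarrow> nat \<Rightarrow> nat \<Rightarrow> 'a block set set" where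
  "groomings2 X V C C' = {G \<in> groomings X C. \<forall>B\<in>G. card {e \<in> B. e \<subseteq> V} \<le> C'}"

definition drop_cost :: "'a block set \<Rightarrow> nat" where
  "drop_cost G = (\<Sum>B\<in>G. card (\<Union>B))"

definition wavelengths :: "'a block set \<Rightarrow> nat" where
  "wavelengths G = card G"

definition ON :: "'a set \<Rightarrow> nat \<Rightarrow> 'a block set set" where
  "ON X C = {G. is_arg_min drop_cost (\<lambda>H. H \<in> groomings X C) G}"

definition ON2 :: "'a set \<Rightarrow> 'a set \<Rightarrow> nat \<Rightarrow> nat \<Rightarrow> 'a block set set" where
  "ON2 X V C C' = {G. is_arg_min drop_cost (\<lambda>H. H \<in> groomings2 X V C C') G}"

definition MON :: "'a set \<Rightarrow> nat \<Rightarrow> 'a block set set" where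
  "MON X C = {G. is_arg_min wavelengths (\<lambda>H. H \<in> ON X C) G}"

definition MON2 :: "'a set \<Rightarrow> 'a set \<Rightarrow> nat \<Rightarrow> nat \<Rightarrow> 'a block set set" where
  "MON2 X V C C' = {G. is_arg_min wavelengths (\<lambda>H. H \<in> ON2 X V C C') G}"

text \<open>
  All members of \<open>MON\<close> have the same number of wavelengths; the lemmas below show that
  this common value exists, so that the descriptions are proper.
\<close>

definition wavecost_MON :: "'a set \<Rightarrow> nat \<Rightarrow> nat" where
  "wavecost_MON X C = (THE k. \<exists>G\<in>MON X C. wavelengths G = k)"

definition wavecost_MON2 :: "'a set \<Rightarrow> 'a set \<Rightarrow> nat \<Rightarrow> nat \<Rightarrow> nat" where
  "wavecost_MON2 X V C C' = (THE k. \<exists>G\<in>MON2 X V C C'. wavelengths G = k)"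

lemma ex_is_arg_min_nat:
  fixes f :: "'b \<Rightarrow> nat"
  assumes "P x"
  shows "\<exists>y. is_arg_min f P y"
  using ex_has_least_nat[of P x f] assms by (auto simp: is_arg_min_linorder)

lemma groomings2_nonempty:
  assumes "C \<ge> 1" "C' \<ge> 1"
  shows "groomings2 X V C C' \<noteq> {}"
proof -
  let ?G = "(\<lambda>e. {e}) ` nsets X 2"
  have "partition_on (nsets X 2) ?G"
    by (auto simp: partition_on_def disjoint_def)
  moreover have "card {e' \<in> {e}. e' \<subseteq> V} \<le> C'" for e
    using card_mono[of "{e}" "{e' \<in> {e}. e' \<subseteq> V}"] assms by fastforce
  ultimately have "?G \<in> groomings2 X V C C'"
    using assms by (auto simp: groomings2_def groomings_def)
  then show ?thesis by blast
qed

lemma MON_nonempty: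
  assumes "C \<ge> 1"
  shows "MON X C \<noteq> {}"
proof -
  obtain G where "G \<in> groomings X C"
    using groomings2_nonempty[of C 1 X "{}"] assms by (auto simp: groomings2_def)
  then obtain H where "H \<in> ON X C"
    using ex_is_arg_min_nat[of "\<lambda>H. H \<in> groomings X C"] by (auto simp: ON_def)
  then show ?thesis
    using ex_is_arg_min_nat[of "\<lambda>H. H \<in> ON X C"] by (auto simp: MON_def)
qed

lemma MON2_nonempty:
  assumes "C \<ge> 1" "C' \<ge> 1"
  shows "MON2 X V C C' \<noteq> {}"
proof -
  obtain G where "G \<in> groomings2 X V C C'"
    using groomings2_nonempty[of C C' X V] assms by auto
  then obtain H where "H \<in> ON2 X V C C'"
    using ex_is_arg_min_nat[of "\<lambda>H. H \<in> groomings2 X V C C'"] by (auto simp: ON2_def)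
  then show ?thesis
    using ex_is_arg_min_nat[of "\<lambda>H. H \<in> ON2 X V C C'"] by (auto simp: MON2_def)
qed

lemma wavecost_MON_eq:
  assumes "G \<in> MON X C"
  shows "wavecost_MON X C = wavelengths G"
  unfolding wavecost_MON_def using assms
  by (intro the_equality) (auto simp: MON_def is_arg_min_linorder intro: antisym)

lemma wavecost_MON2_eq:
  assumes "G \<in> MON2 X V C C'"
  shows "wavecost_MON2 X V C C' = wavelengths G"
  unfolding wavecost_MON2_def using assms
  by (intro the_equality) (auto simp: MON2_def is_arg_min_linorder intro: antisym)

end

theory Submission
  imports Defs
begin

text \<open>
  A block with at most four edges has at least as many vertices as edges, so a grooming all of
  whose blocks have as many vertices as edges has minimum cost, and it has the minimum number of
  blocks as soon as \<open>4 * card G \<le> card E + 3\<close>. It therefore suffices to find one such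
  grooming in which no block has two edges inside \<open>V\<close>, and \<open>V\<close> may be enlarged
  until it contains half of the vertices, rounded down.

  Take the positive integers up to \<open>2 * m\<close> as vertices, together with \<open>0\<close> if the number of
  vertices is odd, and the odd numbers as \<open>V\<close>. For \<open>i \<noteq> j\<close> the edges between the pairs
  \<open>{2 * i - 1, 2 * i}\<close> and \<open>{2 * j - 1, 2 * j}\<close> form a 4-cycle with exactly one edge in
  \<open>V\<close>. Hence groomings on two sets of pairs can be put together, and a few explicit small
  groomings suffice.
\<close>

section \<open>Groomings with bounded slack\<close>

definition tight_grooming :: "'a set \<Rightarrow> 'a block \<Rightarrow> nat \<Rightarrow> 'a block set \<Rightarrow> bool" where
  "tight_grooming V E t G \<longleftrightarrow> partition_on E G
     \<and> (\<forall>B\<in>G. card B \<le> 4 \<and> card (\<Union>B) = card B \<and> card {e \<in> B. e \<subseteq> V} \<le> 1)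
     \<and> 4 * card G \<le> card E + t"

definition tight :: "'a set \<Rightarrow> 'a block \<Rightarrow> nat \<Rightarrow> bool" where
  "tight V E t \<longleftrightarrow> finite E \<and> (\<exists>G. tight_grooming V E t G)"

lemma tight_mono:
  assumes "tight V E s" "s \<le> t"
  shows "tight V E t"
  using assms by (fastforce simp: tight_def tight_grooming_def)

lemma tight_empty: "tight V {} t"
  by (auto simp: tight_def tight_grooming_def partition_on_def intro!: exI[of _ "{}"])

lemma tight_block:
  assumes "finite B" "B \<noteq> {}" "card B \<le> 4" "card (\<Union>B) = card B" "card {e \<in> B. e \<subseteq> V} \<le> 1"
  shows "tight V B (4 - card B)"
  unfolding tight_def tight_grooming_def
  using assms by (auto intro!: exI[of _ "{B}"] simp: partition_on_def)

lemma tight_Un: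
  assumes "tight V E s" "tight V F t" "E \<inter> F = {}"
  shows "tight V (E \<union> F) (s + t)"
proof -
  obtain G H where G: "tight_grooming V E s G" and H: "tight_grooming V F t H"
    and fin: "finite E" "finite F"
    using assms by (auto simp: tight_def)
  have "partition_on (E \<union> F) (G \<union> H)"
    using G H assms(3) unfolding tight_grooming_def partition_on_def
    by (auto intro!: disjoint_union)
  moreover have "card (G \<union> H) \<le> card G + card H" by (rule card_Un_le)
  ultimately have "tight_grooming V (E \<union> F) (s + t) (G \<union> H)"
    using G H fin assms(3) by (auto simp: tight_grooming_def card_Un_disjoint)
  then show ?thesis using fin by (auto simp: tight_def)
qed

lemma tight_UN:
  assumes "finite I" "\<And>i. i \<in> I \<Longrightarrow> tight V (E i) 0" "disjoint_family_on E I"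
  shows "tight V (\<Union>i\<in>I. E i) 0"
  using assms
proof (induction I)
  case empty
  then show ?case by (simp add: tight_empty)
next
  case (insert i I)
  then have "tight V (E i \<union> (\<Union>i\<in>I. E i)) (0 + 0)"
    by (intro tight_Un) (auto simp: disjoint_family_on_def)
  then show ?case by simp
qed

text \<open>Blocks are carried along \<open>f\<close>. Since only vertices of \<open>V\<close> may
  land in \<open>W\<close>, an edge inside \<open>W\<close> comes from an edge inside
  \<open>V\<close>; \<open>W\<close> may miss images of vertices of \<open>V\<close>, which is how
  \<open>V\<close> gets enlarged.\<close>

lemma tight_image:
  assumes "tight V (nsets S 2) t" "inj_on f S" "\<And>x. x \<in> S \<Longrightarrow> f x \<in> W \<Longrightarrow> x \<in> V"
  shows "tight W (nsets (f ` S) 2) t"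
proof -
  obtain G where G: "tight_grooming V (nsets S 2) t G" and fin: "finite (nsets S 2)"
    using assms(1) by (auto simp: tight_def)
  have sub: "e \<subseteq> S" if "e \<in> B" "B \<in> G" for e B
    using G that by (auto simp: tight_grooming_def partition_on_def nsets_def)
  have bij: "bij_betw ((`) f) (nsets S 2) (nsets (f ` S) 2)"
    using assms(2) by (intro bij_betw_nsets) (simp add: bij_betw_def)
  then have inj: "inj_on ((`) f) (nsets S 2)" and im: "(`) f ` nsets S 2 = nsets (f ` S) 2"
    by (auto simp: bij_betw_def)
  have Bsub: "B \<subseteq> nsets S 2" if "B \<in> G" for B
    using G that by (auto simp: tight_grooming_def partition_on_def)
  have part: "partition_on (nsets (f ` S) 2) ((`) ((`) f) ` G)"
  proof -
    have P: "partition_on (nsets S 2) G" using G by (simp add: tight_grooming_def)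
    \<comment> \<open>\<open>partition_on_inj_image\<close> deletes empty blocks from the image;
      here there are none.\<close>
    have "(`) ((`) f) ` G - {{}} = (`) ((`) f) ` G" using partition_onD3[OF P] by auto
    then show ?thesis using partition_on_inj_image[OF P inj] by (simp only: im)
  qed
  have blk: "card ((`) f ` B) \<le> 4 \<and> card (\<Union>((`) f ` B)) = card ((`) f ` B)
      \<and> card {e \<in> (`) f ` B. e \<subseteq> W} \<le> 1" if B: "B \<in> G" for B
  proof -
    have fB: "finite B" using Bsub[OF B] fin finite_subset by blast
    have c: "card ((`) f ` B) = card B"
      using inj Bsub[OF B] by (intro card_image) (rule inj_on_subset)
    have "\<Union>B \<subseteq> S" using sub[OF _ B] by blast
    then have "inj_on f (\<Union>B)" using assms(2) inj_on_subset by blast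
    then have u: "card (\<Union>((`) f ` B)) = card (\<Union>B)"
      by (simp only: image_Union[symmetric] card_image)
    have "e \<subseteq> V" if "e \<in> B" "f ` e \<subseteq> W" for e
      using assms(3) sub[OF _ B] that by blast
    then have "{e \<in> (`) f ` B. e \<subseteq> W} \<subseteq> (`) f ` {e \<in> B. e \<subseteq> V}" by blast
    then have "card {e \<in> (`) f ` B. e \<subseteq> W} \<le> card {e \<in> B. e \<subseteq> V}"
      by (rule surj_card_le[rotated]) (use fB in simp)
    moreover have "card B \<le> 4" "card (\<Union>B) = card B" "card {e \<in> B. e \<subseteq> V} \<le> 1"
      using G B by (auto simp: tight_grooming_def)
    ultimately show ?thesis using c u by linarith
  qed
  have "card ((`) ((`) f) ` G) \<le> card G"
    using G fin finite_elements by (intro card_image_le) (auto simp: tight_grooming_def)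
  moreover have "card (nsets (f ` S) 2) = card (nsets S 2)"
    using bij bij_betw_same_card by force
  ultimately have "tight_grooming W (nsets (f ` S) 2) t ((`) ((`) f) ` G)"
    using part blk G by (auto simp: tight_grooming_def)
  then show ?thesis using fin im by (metis finite_imageI tight_def)
qed

section \<open>Optimality of tight groomings\<close>

text \<open>For \<open>k \<le> 3\<close> vertices \<open>k choose 2 \<le> k\<close>; with four or
  more vertices the bound of four edges suffices.\<close>

lemma card_block_le_vertices:
  assumes "B \<subseteq> nsets X 2" "finite X" "card B \<le> 4"
  shows "card B \<le> card (\<Union>B)"
proof (cases "card (\<Union>B) \<ge> 4")
  case False
  have fin: "finite (\<Union>B)"
    using assms by (intro finite_subset[of "\<Union>B" X]) (auto simp: nsets_def)
  have "B \<subseteq> nsets (\<Union>B) 2" using assms(1) by (auto simp: nsets_def)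
  then have "card B \<le> card (\<Union>B) choose 2"
    using card_mono[OF finite_imp_finite_nsets[OF fin]] by (simp flip: card_nsets)
  moreover have "card (\<Union>B) \<in> {0, 1, 2, 3}" using False by auto
  ultimately show ?thesis by (auto simp: choose_two)
qed (use assms in linarith)

text \<open>One grooming attains both minima: it is optimal among all groomings, and those
  restricted on \<open>V\<close> form a subfamily that contains it.\<close>

lemma tight_imp_wavecost_eq:
  assumes "finite X" and "tight V (nsets X 2) 3"
  shows "wavecost_MON2 X V 4 1 = wavecost_MON X 4"
proof -
  obtain G where G: "tight_grooming V (nsets X 2) 3 G"
    using assms by (auto simp: tight_def)
  have fin: "finite (nsets X 2)" using assms(2) by (simp add: tight_def)
  have sum: "(\<Sum>B\<in>H. card B) = card (nsets X 2)" if "H \<in> groomings X 4" for H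
    using that fin by (intro product_partition[symmetric]) (auto simp: groomings_def partition_on_def intro: finite_subset)
  have G2: "G \<in> groomings2 X V 4 1" and G1: "G \<in> groomings X 4"
    using G by (auto simp: tight_grooming_def groomings_def groomings2_def)
  have cost: "drop_cost G \<le> drop_cost H" if H: "H \<in> groomings X 4" for H
  proof -
    have "drop_cost G = card (nsets X 2)"
      using G sum[OF G1] by (simp add: drop_cost_def tight_grooming_def)
    also have "\<dots> = (\<Sum>B\<in>H. card B)" using sum[OF H] by simp
    also have "\<dots> \<le> drop_cost H"
      unfolding drop_cost_def using H assms(1)
      by (intro sum_mono card_block_le_vertices[of _ X]) (auto simp: groomings_def partition_on_def)
    finally show ?thesis .
  qed
  have waves: "wavelengths G \<le> wavelengths H" if H: "H \<in> groomings X 4" for H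
  proof -
    have "(\<Sum>B\<in>H. card B) \<le> (\<Sum>B\<in>H. 4)"
      using H by (intro sum_mono) (auto simp: groomings_def)
    then have "card (nsets X 2) \<le> 4 * card H" using sum[OF H] by simp
    \<comment> \<open>The slack 3 is less than the capacity of a block:
      \<open>4 * card G \<le> 4 * card H + 3\<close> forces
      \<open>card G \<le> card H\<close>.\<close>
    then show ?thesis using G by (simp add: tight_grooming_def wavelengths_def)
  qed
  have "G \<in> MON X 4" "G \<in> MON2 X V 4 1"
    using G1 G2 cost waves
    by (auto simp: MON_def ON_def MON2_def ON2_def groomings2_def is_arg_min_linorder)
  then show ?thesis by (simp add: wavecost_MON_eq wavecost_MON2_eq)
qed

section \<open>Complete graphs built from pairs\<close>

abbreviation odds :: "nat set" where
  "odds \<equiv> {x. odd x}"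

text \<open>The odd vertices \<open>a\<close> and \<open>b\<close> are neighbours on the cycle, so
  \<open>{a, b}\<close> is its only edge inside \<open>odds\<close>; four edges leave no
  slack.\<close>

lemma tight_quad:
  fixes a b c d :: nat
  assumes "odd a" "odd b" "even c" "even d" "a \<noteq> b" "c \<noteq> d"
  shows "tight odds {{a, b}, {b, c}, {c, d}, {d, a}} 0"
proof -
  have ne: "a \<noteq> c" "a \<noteq> d" "b \<noteq> c" "b \<noteq> d" using assms by auto
  have "card {{a, b}, {b, c}, {c, d}, {d, a}} = 4"
    using assms ne by (auto simp: doubleton_eq_iff card_insert_if)
  moreover have "card (\<Union>{{a, b}, {b, c}, {c, d}, {d, a}}) = 4"
    using assms ne by (auto simp: card_insert_if)
  moreover have "{e \<in> {{a, b}, {b, c}, {c, d}, {d, a}}. e \<subseteq> odds} = {{a, b}}"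
    using assms by auto
  ultimately show ?thesis
    using tight_block[of "{{a, b}, {b, c}, {c, d}, {d, a}}" odds] by simp
qed

lemma tight_cross:
  "tight odds {{x, y} | x y. x \<in> {1..2 * m} \<and> y \<in> {2 * m + 1..2 * (m + k)}} 0"
proof -
  \<comment> \<open>Pairs are numbered from 0 here: pair \<open>i\<close> is
    \<open>{2 * i + 1, 2 * i + 2}\<close>, and \<open>E (i, j)\<close> is the 4-cycle between pairs
    \<open>i\<close> and \<open>j\<close>.\<close>
  define E where "E = (\<lambda>(i, j).
    {{2 * i + 1, 2 * j + 1}, {2 * j + 1, 2 * i + 2}, {2 * i + 2, 2 * j + 2}, {2 * j + 2, 2 * i + 1 :: nat}})"
  let ?I = "{..<m} \<times> {m..<m + k}"
  have pair: "\<exists>i. x = 2 * i + 1 \<or> x = 2 * i + 2" if "x \<ge> 1" for x :: nat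
    using that by presburger
  have 1: "{{x, y} | x y. x \<in> {1..2 * m} \<and> y \<in> {2 * m + 1..2 * (m + k)}} = (\<Union>p\<in>?I. E p)"
    (is "?L = ?R")
  proof
    show "?L \<subseteq> ?R"
    proof
      fix e assume "e \<in> ?L"
      then obtain x y where e: "e = {x, y}" and x: "1 \<le> x" "x \<le> 2 * m"
        and y: "2 * m + 1 \<le> y" "y \<le> 2 * (m + k)" by auto
      obtain i j where "x = 2 * i + 1 \<or> x = 2 * i + 2" "y = 2 * j + 1 \<or> y = 2 * j + 2"
        using pair[of x] pair[of y] x y by auto
      moreover from this have "(i, j) \<in> ?I" using x y by auto
      ultimately show "e \<in> ?R"
        by (intro UN_I[of "(i, j)"]) (auto simp: e E_def insert_commute)
    qed
    have L: "{x, y} \<in> ?L" if "x \<in> {1..2 * m}" "y \<in> {2 * m + 1..2 * (m + k)}" for x y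
      using that by blast
    show "?R \<subseteq> ?L"
    proof
      fix e assume "e \<in> ?R"
      then obtain i j where ij: "i < m" "m \<le> j" "j < m + k" and e: "e \<in> E (i, j)" by auto
      from e consider "e = {2 * i + 1, 2 * j + 1}" | "e = {2 * i + 2, 2 * j + 1}"
        | "e = {2 * i + 2, 2 * j + 2}" | "e = {2 * i + 1, 2 * j + 2}"
        by (auto simp: E_def)
      then show "e \<in> ?L"
        by cases (simp only:, rule L; use ij in simp)+
    qed
  qed
  have "tight odds (\<Union>p\<in>?I. E p) 0"
  proof (rule tight_UN)
    \<comment> \<open>\<open>(x - 1) div 2\<close> is the index of the pair containing
      \<open>x\<close>, so an edge determines \<open>{i, j}\<close>, and
      \<open>i < m \<le> j\<close> then fixes the order.\<close>
    have half: "(\<lambda>x. (x - 1) div 2) ` e = {i, j}" if "e \<in> E (i, j)" for e i j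
      using that by (auto simp: E_def)
    have "p = q" if "p \<in> ?I" "q \<in> ?I" "e \<in> E p" "e \<in> E q" for p q e
    proof -
      obtain i j i' j' where "p = (i, j)" "q = (i', j')" by fastforce
      moreover from this have "{i, j} = {i', j'}" using half that(3,4) by metis
      ultimately show ?thesis using that(1,2) by (auto simp: doubleton_eq_iff)
    qed
    then show "disjoint_family_on E ?I" unfolding disjoint_family_on_def by blast
  next
    fix p assume "p \<in> ?I"
    then show "tight odds (E p) 0"
      unfolding E_def by (cases p) (auto intro!: tight_quad)
  qed simp
  then show ?thesis using 1 by simp
qed

text \<open>With \<open>Z = {}\<close> this is \<open>K_{2m}\<close>, with \<open>Z = {0}\<close> it
  is \<open>K_{2m+1}\<close>; the extra vertex 0 is even, hence outside \<open>odds\<close>.\<close>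

definition pairs_graph :: "nat set \<Rightarrow> nat \<Rightarrow> nat block" where
  "pairs_graph Z m = nsets (Z \<union> {1..2 * m}) 2"

text \<open>Edges lie on \<open>Z\<close> and the first \<open>m\<close> pairs, on \<open>Z\<close>
  and the last \<open>k\<close> pairs, or across, where \<open>tight_cross\<close> adds no slack.
  The first two classes are disjoint because \<open>Z\<close> has at most one vertex.\<close>

lemma tight_pairs_graph_add:
  assumes "Z = {} \<or> Z = {0}"
    and "tight odds (pairs_graph Z m) s" "tight odds (pairs_graph Z k) t"
  shows "tight odds (pairs_graph Z (m + k)) (s + t)"
proof -
  \<comment> \<open>\<open>f\<close> fixes the common vertex 0 and shifts the pairs by an even
    amount, so parity is kept.\<close>
  define f where "f x = (if x = 0 then 0 else x + 2 * m)" for x :: nat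
  have im: "f ` (Z \<union> {1..2 * k}) = Z \<union> {2 * m + 1..2 * (m + k)}"
  proof -
    have "f ` {1..2 * k} = (\<lambda>x. x + 2 * m) ` {1..2 * k}"
      by (intro image_cong) (auto simp: f_def)
    also have "\<dots> = {2 * m + 1..2 * (m + k)}"
      by (simp only: image_add_atLeastAtMost') (simp add: algebra_simps)
    finally have "f ` {1..2 * k} = {2 * m + 1..2 * (m + k)}" .
    moreover have "f ` Z = Z" using assms(1) by (auto simp: f_def)
    ultimately show ?thesis by (simp only: image_Un)
  qed
  let ?F = "nsets (Z \<union> {2 * m + 1..2 * (m + k)}) 2"
  let ?C = "{{x, y} | x y. x \<in> {1..2 * m} \<and> y \<in> {2 * m + 1..2 * (m + k)}}"
  have "tight odds ?F t"
    unfolding im[symmetric] using assms(3) unfolding pairs_graph_def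
    by (rule tight_image) (auto simp: f_def inj_on_def split: if_splits)
  moreover have "pairs_graph Z m \<inter> ?F = {}"
    using assms(1) by (fastforce simp: pairs_graph_def elim!: nsets2_E)
  ultimately have "tight odds (pairs_graph Z m \<union> ?F) (s + t)"
    using assms(2) by (intro tight_Un)
  moreover have "(pairs_graph Z m \<union> ?F) \<inter> ?C = {}"
    using assms(1) by (auto simp: pairs_graph_def)
  ultimately have "tight odds (pairs_graph Z m \<union> ?F \<union> ?C) (s + t + 0)"
    by (rule tight_Un[OF _ tight_cross])
  moreover have "pairs_graph Z m \<union> ?F \<union> ?C = pairs_graph Z (m + k)" (is "?L = ?R")
  proof
    have "pairs_graph Z m \<subseteq> ?R" "?F \<subseteq> ?R"
      unfolding pairs_graph_def by (intro nsets_mono; auto)+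
    moreover have "?C \<subseteq> ?R" by (auto simp: pairs_graph_def)
    ultimately show "?L \<subseteq> ?R" by blast
    show "?R \<subseteq> ?L"
    proof
      fix e assume "e \<in> ?R"
      then obtain x y where e: "e = {x, y}" "x < y"
        and mem: "x \<in> Z \<union> {1..2 * (m + k)}" "y \<in> Z \<union> {1..2 * (m + k)}"
        by (auto simp: pairs_graph_def ordered_nsets_2_eq)
      \<comment> \<open>Being the larger end, \<open>y\<close> is not 0; the extra vertex can only
        be \<open>x\<close>.\<close>
      have y: "1 \<le> y" "y \<le> 2 * (m + k)" using assms(1) mem e(2) by auto
      show "e \<in> ?L"
      proof (cases "y \<le> 2 * m")
        case True
        then have "e \<in> pairs_graph Z m"
          using e mem y by (auto simp: pairs_graph_def)
        then show ?thesis by blast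
      next
        case False
        show ?thesis
        proof (cases "x \<in> Z \<or> x > 2 * m")
          case True
          then have "e \<in> ?F" using e mem y False by auto
          then show ?thesis by blast
        next
          case 2: False
          then have "x \<in> {1..2 * m}" "y \<in> {2 * m + 1..2 * (m + k)}"
            using mem y False by auto
          then show ?thesis using e(1) by blast
        qed
      qed
    qed
  qed
  ultimately show ?thesis by simp
qed

section \<open>Explicit groomings checked by evaluation\<close>

text \<open>Explicit edges are pairs of numbers, which can be compared by evaluation; with the
  smaller end first, the encoding is injective.\<close>

definition edge :: "nat \<times> nat \<Rightarrow> nat set" where
  "edge p = {fst p, snd p}"

definition tight_list :: "(nat \<times> nat) list \<Rightarrow> bool" where
  "tight_list b \<longleftrightarrow> b \<noteq> [] \<and> length b \<le> 4
     \<and> length (remdups (map fst b @ map snd b)) = length b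
     \<and> length (filter (\<lambda>p. odd (fst p) \<and> odd (snd p)) b) \<le> 1"

lemma inj_on_edge: "inj_on edge {p. fst p < snd p}"
  by (auto simp: inj_on_def edge_def doubleton_eq_iff)

lemma tight_edge_list:
  assumes "tight_list b" "distinct b" "\<forall>p\<in>set b. fst p < snd p"
  shows "tight odds (edge ` set b) (4 - length b)"
proof -
  have inj: "inj_on edge (set b)"
    using assms(3) by (intro inj_on_subset[OF inj_on_edge]) auto
  have c: "card (edge ` set b) = length b"
    using assms(2) inj by (simp add: card_image distinct_card)
  have "\<Union>(edge ` set b) = set (map fst b @ map snd b)"
    by (auto simp: edge_def)
  then have u: "card (\<Union>(edge ` set b)) = length b"
    using assms(1) by (simp only: tight_list_def length_remdups_card_conv)
  define F where "F = filter (\<lambda>p. odd (fst p) \<and> odd (snd p)) b"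
  have "{e \<in> edge ` set b. e \<subseteq> odds} = edge ` set F"
    by (auto simp: edge_def F_def)
  also have "card \<dots> \<le> card (set F)" by (intro card_image_le) simp
  also have "\<dots> \<le> length F" by (rule card_length)
  also have "\<dots> \<le> 1" using assms(1) by (simp add: tight_list_def F_def)
  finally have "card {e \<in> edge ` set b. e \<subseteq> odds} \<le> 1" .
  then show ?thesis
    using tight_block[of "edge ` set b" odds] c u assms(1) by (auto simp: tight_list_def)
qed

lemma tight_edge_lists:
  assumes "\<forall>b\<in>set bs. tight_list b" "distinct (concat bs)" "\<forall>p\<in>set (concat bs). fst p < snd p"
  shows "tight odds (edge ` set (concat bs)) (\<Sum>b\<leftarrow>bs. 4 - length b)"
  using assms
proof (induction bs)
  case Nil
  then show ?case by (simp add: tight_empty)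
next
  case (Cons b bs)
  have "inj_on edge (set b \<union> set (concat bs))"
    using Cons.prems(3) by (intro inj_on_subset[OF inj_on_edge]) auto
  moreover have "set b \<inter> set (concat bs) = {}" using Cons.prems(2) by auto
  ultimately have "edge ` set b \<inter> edge ` set (concat bs) = {}"
    by (metis image_empty inj_on_image_Int Un_upper1 Un_upper2)
  then have "tight odds (edge ` set b \<union> edge ` set (concat bs))
      ((4 - length b) + (\<Sum>b\<leftarrow>bs. 4 - length b))"
    using Cons by (intro tight_Un tight_edge_list) auto
  then show ?case by (simp add: image_Un)
qed

text \<open>The hypotheses can be evaluated on concrete lists: distinctness of
  \<open>concat bs\<close> makes the blocks disjoint, and comparison with all increasing pairs from
  \<open>xs\<close> shows that they cover the complete graph.\<close>

lemma tight_nsets_by_list: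
  assumes "list_all tight_list bs" "distinct (concat bs)"
    and "set (concat bs) = set (filter (\<lambda>p. fst p < snd p) (List.product xs xs))"
    and "(\<Sum>b\<leftarrow>bs. 4 - length b) = t" "S = set xs"
  shows "tight odds (nsets S 2) t"
proof -
  have "edge ` set (concat bs) = nsets S 2" (is "?L = ?R")
  proof
    show "?L \<subseteq> ?R" unfolding assms(3,5) by (auto simp: edge_def)
    show "?R \<subseteq> ?L"
    proof
      fix e assume "e \<in> ?R"
      then obtain x y where "e = {x, y}" "x < y" "x \<in> S" "y \<in> S"
        by (auto simp: ordered_nsets_2_eq)
      then have "e = edge (x, y)" "(x, y) \<in> set (concat bs)"
        unfolding assms(3,5) by (auto simp: edge_def)
      then show "e \<in> ?L" by blast
    qed
  qed
  moreover have "tight odds (edge ` set (concat bs)) (\<Sum>b\<leftarrow>bs. 4 - length b)"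
    using assms(1,2,3) by (intro tight_edge_lists) (auto simp: list_all_iff)
  ultimately show ?thesis using assms(4) by simp
qed

text \<open>The groomings below, except the trivial one of \<open>K\<^sub>3\<close>, were found by computer search.\<close>

lemma tight_K6: "tight odds (pairs_graph {} 3) 1"
  unfolding pairs_graph_def
  by (rule tight_nsets_by_list[where xs = "[1..<7]" and bs =
    "[[(1, 2), (1, 3), (2, 3), (3, 6)], [(3, 4), (3, 5), (4, 5)],
      [(1, 4), (1, 5), (1, 6), (5, 6)], [(2, 4), (2, 5), (2, 6), (4, 6)]]"])
    (code_simp | auto)+

lemma tight_K8: "tight odds (pairs_graph {} 4) 0"
  unfolding pairs_graph_def
  by (rule tight_nsets_by_list[where xs = "[1..<9]" and bs =
    "[[(1, 3), (3, 4), (3, 8), (4, 8)], [(3, 5), (3, 6), (4, 6), (5, 6)],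
      [(2, 6), (2, 7), (3, 7), (6, 7)], [(2, 3), (2, 5), (2, 8), (5, 8)],
      [(4, 5), (4, 7), (5, 7), (7, 8)], [(1, 2), (1, 4), (1, 5), (2, 4)],
      [(1, 6), (1, 7), (1, 8), (6, 8)]]"])
    (code_simp | auto)+

lemma tight_K10: "tight odds (pairs_graph {} 5) 3"
  unfolding pairs_graph_def
  by (rule tight_nsets_by_list[where xs = "[1..<11]" and bs =
    "[[(1, 3), (1, 10), (2, 10), (3, 10)], [(1, 5), (2, 5), (2, 8), (5, 8)],
      [(3, 5), (3, 6), (5, 6)], [(5, 7), (5, 10), (6, 7), (7, 10)],
      [(5, 9), (6, 9), (6, 10), (9, 10)], [(1, 4), (1, 8), (4, 5), (4, 8)],
      [(4, 6), (4, 10), (6, 8), (8, 10)], [(1, 6), (1, 9), (2, 6), (2, 9)],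
      [(1, 2), (1, 7), (2, 7)], [(4, 7), (4, 9), (7, 9)],
      [(2, 3), (2, 4), (3, 4), (3, 9)], [(3, 7), (3, 8), (7, 8), (8, 9)]]"])
    (code_simp | auto)+

lemma tight_K3: "tight odds (pairs_graph {0} 1) 1"
  unfolding pairs_graph_def
  by (rule tight_nsets_by_list[where xs = "[0..<3]" and bs = "[[(0, 1), (0, 2), (1, 2)]]"])
    (code_simp | auto)+

lemma tight_K9: "tight odds (pairs_graph {0} 4) 0"
  unfolding pairs_graph_def
  by (rule tight_nsets_by_list[where xs = "[0..<9]" and bs =
    "[[(0, 1), (0, 3), (0, 4), (1, 3)], [(1, 4), (1, 5), (4, 5), (5, 8)],
      [(2, 3), (2, 8), (3, 5), (3, 8)], [(3, 4), (3, 7), (4, 6), (4, 7)],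
      [(2, 4), (2, 7), (4, 8), (7, 8)], [(1, 2), (1, 6), (2, 6), (3, 6)],
      [(0, 7), (0, 8), (1, 7), (1, 8)], [(5, 6), (5, 7), (6, 7), (6, 8)],
      [(0, 2), (0, 5), (0, 6), (2, 5)]]"])
    (code_simp | auto)+

section \<open>All numbers of pairs\<close>

text \<open>Splitting off the four pairs of \<open>tight_K8\<close> costs no slack, but needs
  \<open>m - 4 \<ge> 3\<close>. So \<open>m = 6\<close> is treated separately as 3 + 3, with slack 1
  + 1.\<close>

lemma tight_even: "m \<ge> 3 \<Longrightarrow> tight odds (pairs_graph {} m) 3"
proof (induction m rule: less_induct)
  case (less m)
  consider "m = 3" | "m = 4" | "m = 5" | "m = 6" | "m \<ge> 7" using less.prems by linarith
  then show ?case
  proof cases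
    case 4
    then show ?thesis
      using tight_mono[OF tight_pairs_graph_add[OF _ tight_K6 tight_K6], of 3] by simp
  next
    case 5
    then have "tight odds (pairs_graph {} (m - 4)) 3" using less.IH by simp
    then show ?thesis
      using tight_pairs_graph_add[OF _ _ tight_K8, of "m - 4" 3] 5 by simp
  qed (use tight_mono[OF tight_K6, of 3] tight_mono[OF tight_K8, of 3] tight_K10 in simp_all)
qed

text \<open>Each triangle through 0 costs one unit of slack, so triangles alone serve up to three
  pairs. Beyond that, \<open>tight_K9\<close> removes four pairs at no cost, down to the edgeless
  case \<open>m = 0\<close>.\<close>

lemma tight_odd: "tight odds (pairs_graph {0} m) 3"
proof (induction m rule: less_induct)
  case (less m)
  have K5: "tight odds (pairs_graph {0} 2) 2"
    using tight_pairs_graph_add[OF _ tight_K3 tight_K3] by (simp add: numeral_2_eq_2)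
  have K7: "tight odds (pairs_graph {0} 3) 3"
    using tight_pairs_graph_add[OF _ K5 tight_K3] by (simp add: numeral_eq_Suc)
  have K1: "tight odds (pairs_graph {0} 0) 0"
  proof -
    have "pairs_graph {0} 0 = {}" by (auto simp: pairs_graph_def nsets_def card_2_iff)
    then show ?thesis by (simp add: tight_empty)
  qed
  consider "m = 0" | "m = 1" | "m = 2" | "m = 3" | "m \<ge> 4" by linarith
  then show ?case
  proof cases
    case 5
    then have "tight odds (pairs_graph {0} (m - 4)) 3" using less.IH by simp
    then show ?thesis
      using tight_pairs_graph_add[OF _ _ tight_K9, of "m - 4" 3] 5 by simp
  qed (use tight_mono[OF K1, of 3] tight_mono[OF tight_K3, of 3] tight_mono[OF K5, of 3] K7
      in simp_all)
qed

lemma card_odds_atMost_double: "card (odds \<inter> {1..2 * m}) = m"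
proof -
  have "odds \<inter> {1..2 * m} = (\<lambda>i. 2 * i + 1) ` {..<m}"
    by (auto elim!: oddE)
  then show ?thesis by (simp add: card_image inj_on_def)
qed

section \<open>Transfer to arbitrary vertex sets\<close>

text \<open>There are \<open>card X div 2\<close> odd vertices, enough to choose a set
  \<open>U\<close> of them to map onto \<open>V\<close>; all other vertices, odd or even, go to
  \<open>X - V\<close>.\<close>

lemma tight_complete:
  assumes "finite X" "V \<subseteq> X" "card X \<ge> 5" "2 * card V \<le> card X"
  shows "tight V (nsets X 2) 3"
proof -
  define m where "m = card X div 2"
  define Z where "Z = (if even (card X) then {} else {0 :: nat})"
  define S where "S = Z \<union> {1..2 * m}"
  have "tight odds (nsets S 2) 3"
  proof (cases "even (card X)")
    case True
    \<comment> \<open>An even number that is at least 5 is at least 6.\<close>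
    then have "m \<ge> 3" using assms(3) by (auto simp: m_def elim!: evenE)
    then show ?thesis using tight_even[of m] True by (simp add: S_def Z_def pairs_graph_def)
  next
    case False
    then show ?thesis using tight_odd[of m] by (simp add: S_def Z_def pairs_graph_def)
  qed
  moreover have finS: "finite S" and cardS: "card S = card X"
    by (auto simp: S_def Z_def m_def)
  moreover have "card V \<le> card (odds \<inter> {1..2 * m})"
    using assms(4) unfolding card_odds_atMost_double m_def by simp
  then obtain U where U: "U \<subseteq> odds \<inter> {1..2 * m}" "card U = card V"
    using obtain_subset_with_card_n by metis
  have US: "U \<subseteq> S" and Uodd: "U \<subseteq> odds" using U(1) by (auto simp: S_def)
  have finU: "finite U" and finV: "finite V"
    using US finS assms(1,2) finite_subset by blast+
  obtain g where g: "bij_betw g U V"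
    using finite_same_card_bij[OF finU finV U(2)] by blast
  have "card (S - U) = card (X - V)"
    using US assms(2) finU finV cardS U(2) by (simp add: card_Diff_subset)
  then obtain h where h: "bij_betw h (S - U) (X - V)"
    using finite_same_card_bij[of "S - U" "X - V"] finS assms(1) by auto
  define f where "f x = (if x \<in> U then g x else h x)" for x
  have fg: "bij_betw f U V" using g by (simp add: f_def cong: bij_betw_cong)
  have fh: "bij_betw f (S - U) (X - V)"
    using h bij_betw_cong[of "S - U" f h] by (auto simp: f_def)
  have "bij_betw f (U \<union> (S - U)) (V \<union> (X - V))"
    using bij_betw_combine[OF fg fh] by blast
  then have f: "bij_betw f S X" using US assms(2) by (simp add: Un_absorb1)
  \<comment> \<open>Vertices outside \<open>U\<close> are sent outside \<open>V\<close>, so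
    \<open>x\<close> lies in \<open>U\<close>.\<close>
  have "x \<in> odds" if "x \<in> S" "f x \<in> V" for x
    using that fh Uodd by (auto simp: bij_betw_def)
  ultimately show ?thesis
    using tight_image[of odds S 3 f V] f by (auto simp: bij_betw_def)
qed

theorem theorem3p2:
  fixes X V :: "'a set" and v w :: nat
  assumes "finite X" and "V \<subseteq> X" and "card X = v + w" and "card V = v"
    and "v + w \<ge> 5" and "v \<le> w"
  shows "wavecost_MON2 X V 4 1 = wavecost_MON X 4"
  using assms by (intro tight_imp_wavecost_eq tight_complete) auto

end
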